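(* For every fixed integer $k\ge 2$, the limits $$s_k:=\lim_{n\to\infty}s(n,k)\qquad\text{and}\qquad s'_k:=\lim_{n\to\infty}s'(n,k)$$ exist and satisfy $$0<s'_k\le s_k<1 .$$
   Context: A hypergraph $\mathcal{H}=(X,\mathcal{E})$ consists of a finite vertex set $X$ and a set $\mathcal{E}$ of subsets of $X$. For an integer $q\ge 1$, $\mathcal{H}$ is $q$-linear if $|E\cap E'|<q$ for all distinct $E,E'\in\mathcal{E}$. For a set $S$, $\binom{S}{k}$ denotes the collection of its $k$-element subsets. Let $\mathcal{E}_k:=\bigcup_{E\in\mathcal{E}}\binom{E}{k}$, $\mathcal{E}^0_{k+1}:=\{F\in\binom{X}{k+1}:\binom{F}{k}\cap\mathcal{E}_k=\emptyset\}$ and $\mathcal{S}_k(\mathcal{H}):=\mathcal{E}_k\cup\mathcal{E}^0_{k+1}$. For $n\ge k+1$ define $$s(n,k):=\min_{\mathcal{H}}\sum_{S\in\mathcal{S}_k(\mathcal{H})}\binom{n}{|S|}^{-1},$$ the minimum taken over all $(k-1)$-linear hypergraphs $\mathcal{H}=(X,\mathcal{E})$ with $|X|=n$, and let $s'(n,k)$ be the minimum of the same sum over all hypergraphs $\mathcal{H}=(X,\mathcal{E})$ with $|X|=n$ (not necessarily $(k-1)$-linear). *)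

theory Defs
  imports Complex_Main "HOL-Library.Ramsey"
begin

definition hypergraph :: "'a set \<Rightarrow> 'a set set \<Rightarrow> bool" where
  "hypergraph X \<E> \<longleftrightarrow> finite X \<and> \<E> \<subseteq> Pow X"

definition linear_edges :: "nat \<Rightarrow> 'a set set \<Rightarrow> bool" where
  "linear_edges q \<E> \<longleftrightarrow> (\<forall>E\<in>\<E>. \<forall>E'\<in>\<E>. E \<noteq> E' \<longrightarrow> card (E \<inter> E') < q)"

definition covered_sets :: "nat \<Rightarrow> 'a set set \<Rightarrow> 'a set set" where
  "covered_sets k \<E> = (\<Union>E\<in>\<E>. [E]\<^bsup>k\<^esup>)"

definition uncovered_sets :: "nat \<Rightarrow> 'a set \<Rightarrow> 'a set set \<Rightarrow> 'a set set" where
  "uncovered_sets k X \<E> = {F \<in> [X]\<^bsup>(k + 1)\<^esup>. [F]\<^bsup>k\<^esup> \<inter> covered_sets k \<E> = {}}"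

definition S_sets :: "nat \<Rightarrow> 'a set \<Rightarrow> 'a set set \<Rightarrow> 'a set set" where
  "S_sets k X \<E> = covered_sets k \<E> \<union> uncovered_sets k X \<E>"

definition weight :: "nat \<Rightarrow> 'a set \<Rightarrow> 'a set set \<Rightarrow> real" where
  "weight k X \<E> = (\<Sum>S\<in>S_sets k X \<E>. inverse (real (card X choose card S)))"

text \<open>
  The weight is invariant under renaming vertices, so taking the vertices to be
  natural numbers loses no generality.
\<close>

definition min_weight_linear :: "nat \<Rightarrow> nat \<Rightarrow> real" where
  "min_weight_linear n k = Min {weight k X \<E> | (X :: nat set) \<E>.
     hypergraph X \<E> \<and> card X = n \<and> linear_edges (k - 1) \<E>}"

definition min_weight :: "nat \<Rightarrow> nat \<Rightarrow> real" where
  "min_weight n k = Min {weight k X \<E> | (X :: nat set) \<E>. hypergraph X \<E> \<and> card X = n}"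

text \<open>The minima are taken over finite nonempty sets, hence are genuine minima.\<close>

lemma weight_in_finite_set:
  assumes "hypergraph X \<E>"
  shows "weight k X \<E> \<in> (\<lambda>(a, b). real a * inverse (real (card X choose k))
           + real b * inverse (real (card X choose (k + 1))))
         ` ({..card X choose k} \<times> {..card X choose (k + 1)})"
proof -
  have X: "finite X" and EX: "\<E> \<subseteq> Pow X"
    using assms by (auto simp: hypergraph_def)
  let ?A = "covered_sets k \<E>" and ?B = "uncovered_sets k X \<E>"
  have A: "?A \<subseteq> [X]\<^bsup>k\<^esup>" and B: "?B \<subseteq> [X]\<^bsup>(k + 1)\<^esup>"
    using EX by (auto simp: covered_sets_def uncovered_sets_def nsets_def)
  have fin: "finite ([X]\<^bsup>k\<^esup>)" "finite ([X]\<^bsup>(k + 1)\<^esup>)"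
    using X by (simp_all add: finite_imp_finite_nsets)
  have cA: "card S = k" if "S \<in> ?A" for S using A that by (auto simp: nsets_def)
  have cB: "card S = k + 1" if "S \<in> ?B" for S using B that by (auto simp: nsets_def)
  have "?A \<inter> ?B = {}" by (metis cA cB disjoint_iff n_not_Suc_n Suc_eq_plus1)
  then have "weight k X \<E> = (\<Sum>S\<in>?A. inverse (real (card X choose card S)))
      + (\<Sum>S\<in>?B. inverse (real (card X choose card S)))"
    unfolding weight_def S_sets_def
    by (intro sum.union_disjoint finite_subset[OF A fin(1)] finite_subset[OF B fin(2)])
  also have "\<dots> = real (card ?A) * inverse (real (card X choose k))
      + real (card ?B) * inverse (real (card X choose (k + 1)))"
    using cA cB by simp
  finally have w: "weight k X \<E> = real (card ?A) * inverse (real (card X choose k))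
      + real (card ?B) * inverse (real (card X choose (k + 1)))" .
  have "card ?A \<le> card X choose k" "card ?B \<le> card X choose (k + 1)"
    using card_mono[OF fin(1) A] card_mono[OF fin(2) B] by (simp_all only: card_nsets)
  then have "(card ?A, card ?B) \<in> {..card X choose k} \<times> {..card X choose (k + 1)}"
    by simp
  then show ?thesis
    by (rule rev_image_eqI) (simp only: w prod.case)
qed

lemma finite_weights':
  "finite {weight k X \<E> | (X :: nat set) \<E>. hypergraph X \<E> \<and> card X = n}"
    (is "finite ?W")
proof (rule finite_subset)
  show "?W \<subseteq> (\<lambda>(a, b). real a * inverse (real (n choose k))
           + real b * inverse (real (n choose (k + 1))))
         ` ({..n choose k} \<times> {..n choose (k + 1)})" (is "_ \<subseteq> ?R")
  proof
    fix w assume "w \<in> ?W"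
    then obtain X :: "nat set" and \<E>
      where w: "w = weight k X \<E>" and "hypergraph X \<E>" and n: "card X = n"
      by blast
    from weight_in_finite_set[OF \<open>hypergraph X \<E>\<close>, of k]
    show "w \<in> ?R" by (simp only: w n)
  qed
qed (intro finite_imageI finite_cartesian_product finite_atMost)

lemma finite_weights:
  "finite {weight k X \<E> | (X :: nat set) \<E>.
     hypergraph X \<E> \<and> card X = n \<and> linear_edges (k - 1) \<E>}"
  by (rule finite_subset[OF _ finite_weights'[of k n]]) fast

lemma nonempty_weights:
  "{weight k X \<E> | (X :: nat set) \<E>.
     hypergraph X \<E> \<and> card X = n \<and> linear_edges (k - 1) \<E>} \<noteq> {}"
proof -
  have "hypergraph {..<n} {}" "card {..<n} = n" "linear_edges (k - 1) ({} :: nat set set)"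
    by (simp_all add: hypergraph_def linear_edges_def)
  then show ?thesis by blast
qed

lemma nonempty_weights':
  "{weight k X \<E> | (X :: nat set) \<E>. hypergraph X \<E> \<and> card X = n} \<noteq> {}"
  using nonempty_weights[of k n] by fast

end

theory Submission imports Defs begin

text \<open>
  Deleting a vertex \<open>x\<close> turns \<open>S_sets k X \<E>\<close> into the family of those of its members that avoid
  \<open>x\<close>. As a \<open>j\<close>-set avoids a vertex chosen uniformly from \<open>n + 1\<close> vertices with probability
  \<open>(n + 1 - j) / (n + 1)\<close>, which is the ratio of \<open>n choose j\<close> to \<open>(n + 1) choose j\<close>, the weight of a
  hypergraph is the average of the weights of its vertex-deleted subhypergraphs
  (\<open>sum_weight_delete_vertex\<close>). Hence some deletion does not increase the weight. Deletion
  preserves linearity, so both minima are nondecreasing in \<open>n\<close> once \<open>n \<ge> k + 1\<close>, and both limits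
  are bounded below by values of the minima, which are positive.

  For the upper bound a single edge suffices, and one edge is linear for trivial reasons. Let \<open>E\<close> be
  half of \<open>2 m\<close> vertices and let \<open>a\<close> be the density of the \<open>k\<close>-sets inside \<open>E\<close>. A \<open>(k+1)\<close>-set with
  exactly one vertex outside \<open>E\<close> contains a covered \<open>k\<close>-set, and such sets have density at least
  \<open>a (k + 1) / 2\<close> among all \<open>(k+1)\<close>-sets. So the weight is at most \<open>1 + a - a (k + 1) / 2\<close>, which is
  at most \<open>1 - a / 2\<close>, and \<open>a\<close> is bounded below independently of \<open>m\<close> (\<open>min_weight_linear_le\<close>).
\<close>

section \<open>The weight in terms of the two families\<close>

lemma covered_sets_subset: "hypergraph X \<E> \<Longrightarrow> covered_sets k \<E> \<subseteq> [X]\<^bsup>k\<^esup>"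
  by (auto simp: hypergraph_def covered_sets_def nsets_def)

lemma uncovered_sets_subset: "uncovered_sets k X \<E> \<subseteq> [X]\<^bsup>(k + 1)\<^esup>"
  by (auto simp: uncovered_sets_def)

lemma finite_covered_sets: "hypergraph X \<E> \<Longrightarrow> finite (covered_sets k \<E>)"
  by (meson covered_sets_subset finite_imp_finite_nsets finite_subset hypergraph_def)

lemma finite_uncovered_sets: "hypergraph X \<E> \<Longrightarrow> finite (uncovered_sets k X \<E>)"
  by (meson uncovered_sets_subset finite_imp_finite_nsets finite_subset hypergraph_def)

lemma weight_eq_card:
  assumes "hypergraph X \<E>"
  shows "weight k X \<E> = real (card (covered_sets k \<E>)) / real (card X choose k)
      + real (card (uncovered_sets k X \<E>)) / real (card X choose (k + 1))"
proof -
  have cA: "card S = k" if "S \<in> covered_sets k \<E>" for S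
    using that by (auto simp: covered_sets_def nsets_def)
  have cB: "card S = k + 1" if "S \<in> uncovered_sets k X \<E>" for S
    using that by (auto simp: uncovered_sets_def nsets_def)
  have "covered_sets k \<E> \<inter> uncovered_sets k X \<E> = {}"
    by (metis cA cB disjoint_iff n_not_Suc_n Suc_eq_plus1)
  then have "weight k X \<E> = (\<Sum>S\<in>covered_sets k \<E>. inverse (real (card X choose card S)))
      + (\<Sum>S\<in>uncovered_sets k X \<E>. inverse (real (card X choose card S)))"
    unfolding weight_def S_sets_def
    using finite_covered_sets[OF assms] finite_uncovered_sets[OF assms]
    by (intro sum.union_disjoint)
  then show ?thesis
    using cA cB by (simp add: divide_inverse)
qed

lemma weight_pos:
  assumes H: "hypergraph X \<E>" and n: "card X \<ge> k + 1"
  shows "weight k X \<E> > 0"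
proof (cases "covered_sets k \<E> = {}")
  case True
  then have "uncovered_sets k X \<E> = [X]\<^bsup>(k + 1)\<^esup>"
    by (simp add: uncovered_sets_def)
  then have "card (uncovered_sets k X \<E>) = card X choose (k + 1)"
    by (simp only: card_nsets)
  then show ?thesis
    using n True by (simp add: weight_eq_card[OF H])
next
  case False
  then have "card (covered_sets k \<E>) > 0"
    using finite_covered_sets[OF H] by (simp add: card_gt_0_iff)
  then have "real (card (covered_sets k \<E>)) / real (card X choose k) > 0"
    using n by simp
  then show ?thesis
    by (simp add: weight_eq_card[OF H] add_pos_nonneg)
qed

section \<open>Deleting a vertex\<close>

definition delete_vertex :: "'a \<Rightarrow> 'a set set \<Rightarrow> 'a set set" where
  "delete_vertex x \<E> = (\<lambda>E. E - {x}) ` \<E>"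

lemma hypergraph_delete_vertex:
  "hypergraph X \<E> \<Longrightarrow> hypergraph (X - {x}) (delete_vertex x \<E>)"
  by (auto simp: hypergraph_def delete_vertex_def)

text \<open>
  Two edges may become equal after the deletion; this does no harm, because edges form a set and
  distinct traces come from distinct edges. Finiteness of the edges is needed, since infinite sets
  have cardinality 0.
\<close>

lemma linear_edges_delete_vertex:
  assumes "hypergraph X \<E>" and lin: "linear_edges q \<E>"
  shows "linear_edges q (delete_vertex x \<E>)"
  unfolding linear_edges_def delete_vertex_def
proof (clarsimp)
  fix E E' assume E: "E \<in> \<E>" "E' \<in> \<E>" and ne: "E - {x} \<noteq> E' - {x}"
  have "finite (E \<inter> E')"
    using assms(1) E by (auto simp: hypergraph_def intro: finite_subset)
  then have "card ((E - {x}) \<inter> (E' - {x})) \<le> card (E \<inter> E')"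
    by (intro card_mono) auto
  also have "\<dots> < q"
    using lin E ne by (auto simp: linear_edges_def)
  finally show "card ((E - {x}) \<inter> (E' - {x})) < q" .
qed

lemma S_sets_delete_vertex:
  "S_sets k (X - {x}) (delete_vertex x \<E>) = {S \<in> S_sets k X \<E>. x \<notin> S}"
proof -
  have cov: "covered_sets k (delete_vertex x \<E>) = {S \<in> covered_sets k \<E>. x \<notin> S}"
    by (auto simp: covered_sets_def delete_vertex_def nsets_def)
  have "uncovered_sets k (X - {x}) (delete_vertex x \<E>) = {F \<in> uncovered_sets k X \<E>. x \<notin> F}"
    unfolding uncovered_sets_def cov by (auto simp: nsets_def)
  with cov show ?thesis
    by (auto simp: S_sets_def)
qed

lemma inverse_binomial_Suc:
  assumes "j \<le> n"
  shows "real (Suc n - j) * inverse (real (n choose j))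
    = real (Suc n) * inverse (real (Suc n choose j))"
proof -
  have "real (Suc n - j) * real (Suc n choose j) = real (Suc n) * real (n choose j)"
    using binomial_absorb_comp[of "Suc n" j] by (metis diff_Suc_1 of_nat_mult)
  moreover have "real (n choose j) > 0" "real (Suc n choose j) > 0"
    using assms by simp_all
  ultimately show ?thesis
    by (simp add: field_simps del: binomial_Suc_Suc of_nat_Suc)
qed

text \<open>
  Double counting of the pairs of a vertex and a member of \<open>S_sets k X \<E>\<close> that avoids it. The
  hypothesis on \<open>n\<close> ensures that the binomial coefficients in the deleted hypergraphs are not 0.
\<close>

lemma sum_weight_delete_vertex:
  assumes H: "hypergraph X \<E>" and n: "card X = Suc n" "k + 1 \<le> n"
  shows "(\<Sum>x\<in>X. weight k (X - {x}) (delete_vertex x \<E>)) = real (Suc n) * weight k X \<E>"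
proof -
  let ?S = "S_sets k X \<E>"
  have finX: "finite X"
    using H by (simp add: hypergraph_def)
  have finS: "finite ?S"
    using finite_covered_sets[OF H] finite_uncovered_sets[OF H] by (simp add: S_sets_def)
  have S: "S \<subseteq> X \<and> card S \<le> n" if "S \<in> ?S" for S
    using that n(2) covered_sets_subset[OF H, of k] uncovered_sets_subset[of k X \<E>]
    by (auto simp: S_sets_def nsets_def)
  have "(\<Sum>x\<in>X. weight k (X - {x}) (delete_vertex x \<E>))
      = (\<Sum>x\<in>X. \<Sum>S\<in>{S \<in> ?S. x \<notin> S}. inverse (real (n choose card S)))"
    using n finX by (simp add: weight_def S_sets_delete_vertex)
  also have "\<dots> = (\<Sum>S\<in>?S. \<Sum>x\<in>{x \<in> X. x \<notin> S}. inverse (real (n choose card S)))"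
    by (rule sum.swap_restrict[OF finX finS])
  also have "\<dots> = (\<Sum>S\<in>?S. real (Suc n) * inverse (real (Suc n choose card S)))"
  proof (rule sum.cong[OF refl])
    fix S assume "S \<in> ?S"
    then have sub: "S \<subseteq> X" and le: "card S \<le> n"
      using S by auto
    have "{x \<in> X. x \<notin> S} = X - S"
      by auto
    then have "card {x \<in> X. x \<notin> S} = Suc n - card S"
      using sub finX n(1) by (simp add: card_Diff_subset finite_subset)
    then show "(\<Sum>x\<in>{x \<in> X. x \<notin> S}. inverse (real (n choose card S)))
        = real (Suc n) * inverse (real (Suc n choose card S))"
      using inverse_binomial_Suc[OF le] by simp
  qed
  also have "\<dots> = real (Suc n) * weight k X \<E>"
    by (simp only: weight_def n(1) sum_distrib_left)
  finally show ?thesis .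
qed

lemma exists_delete_vertex_weight_le:
  assumes H: "hypergraph X \<E>" and n: "card X = Suc n" "k + 1 \<le> n"
  obtains x where "x \<in> X" "weight k (X - {x}) (delete_vertex x \<E>) \<le> weight k X \<E>"
proof -
  have "\<exists>x\<in>X. weight k (X - {x}) (delete_vertex x \<E>) \<le> weight k X \<E>"
  proof (rule ccontr)
    assume "\<not> ?thesis"
    moreover have "finite X" "X \<noteq> {}"
      using H n by (auto simp: hypergraph_def)
    ultimately have "(\<Sum>x\<in>X. weight k X \<E>) < (\<Sum>x\<in>X. weight k (X - {x}) (delete_vertex x \<E>))"
      by (intro sum_strict_mono) (auto simp: not_le)
    then show False
      by (simp add: sum_weight_delete_vertex[OF assms] n(1))
  qed
  then show ?thesis
    using that by blast
qed

section \<open>Monotonicity of the minima\<close>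

lemma min_weight_linear_mono:
  assumes "k + 1 \<le> n"
  shows "min_weight_linear n k \<le> min_weight_linear (Suc n) k"
proof -
  have "min_weight_linear (Suc n) k \<in> {weight k X \<E> | (X :: nat set) \<E>.
      hypergraph X \<E> \<and> card X = Suc n \<and> linear_edges (k - 1) \<E>}"
    unfolding min_weight_linear_def by (rule Min_in[OF finite_weights nonempty_weights])
  then obtain X :: "nat set" and \<E> where w: "min_weight_linear (Suc n) k = weight k X \<E>"
    and H: "hypergraph X \<E>" and n: "card X = Suc n" and lin: "linear_edges (k - 1) \<E>"
    by blast
  obtain x where "x \<in> X" and le: "weight k (X - {x}) (delete_vertex x \<E>) \<le> weight k X \<E>"
    using exists_delete_vertex_weight_le[OF H n assms] .
  then have "card (X - {x}) = n"
    using n by simp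
  then have "min_weight_linear n k \<le> weight k (X - {x}) (delete_vertex x \<E>)"
    unfolding min_weight_linear_def
    using hypergraph_delete_vertex[OF H] linear_edges_delete_vertex[OF H lin]
    by (intro Min_le[OF finite_weights]) blast
  with le w show ?thesis
    by simp
qed

lemma min_weight_mono:
  assumes "k + 1 \<le> n"
  shows "min_weight n k \<le> min_weight (Suc n) k"
proof -
  have "min_weight (Suc n) k \<in> {weight k X \<E> | (X :: nat set) \<E>.
      hypergraph X \<E> \<and> card X = Suc n}"
    unfolding min_weight_def by (rule Min_in[OF finite_weights' nonempty_weights'])
  then obtain X :: "nat set" and \<E> where w: "min_weight (Suc n) k = weight k X \<E>"
    and H: "hypergraph X \<E>" and n: "card X = Suc n"
    by blast
  obtain x where "x \<in> X" and le: "weight k (X - {x}) (delete_vertex x \<E>) \<le> weight k X \<E>"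
    using exists_delete_vertex_weight_le[OF H n assms] .
  then have "card (X - {x}) = n"
    using n by simp
  then have "min_weight n k \<le> weight k (X - {x}) (delete_vertex x \<E>)"
    unfolding min_weight_def
    using hypergraph_delete_vertex[OF H]
    by (intro Min_le[OF finite_weights']) blast
  with le w show ?thesis
    by simp
qed

lemma min_weight_le_linear: "min_weight n k \<le> min_weight_linear n k"
  unfolding min_weight_def min_weight_linear_def
  by (rule Min_antimono[OF _ nonempty_weights finite_weights']) blast

lemma min_weight_pos:
  assumes "k + 1 \<le> n"
  shows "min_weight n k > 0"
  unfolding min_weight_def
  using assms Min_gr_iff[OF finite_weights' nonempty_weights'] weight_pos by blast

section \<open>A single edge\<close>

text \<open>
  Adding a vertex outside \<open>E\<close> to a \<open>k\<close>-subset of \<open>E\<close> gives a \<open>(k+1)\<close>-set that is not uncovered,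
  and both the subset and the vertex can be recovered from it.
\<close>

lemma card_uncovered_single_edge:
  assumes fin: "finite X" and E: "E \<subseteq> X"
  shows "card (uncovered_sets k X {E}) + (card E choose k) * (card X - card E)
    \<le> card X choose (k + 1)"
proof -
  let ?f = "\<lambda>(A, x). insert x A"
  let ?D = "[E]\<^bsup>k\<^esup> \<times> (X - E)"
  have finE: "finite E"
    using E fin by (rule finite_subset)
  have "inj_on ?f ?D"
  proof (rule inj_on_inverseI)
    fix p assume p: "p \<in> ?D"
    then show "(?f p \<inter> E, the_elem (?f p - E)) = p"
    proof (cases p)
      case (Pair A x)
      with p have "A \<subseteq> E" "x \<notin> E"
        by (auto simp: nsets_def)
      then have "insert x A \<inter> E = A" "insert x A - E = {x}"
        by auto
      then show ?thesis
        by (simp add: Pair)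
    qed
  qed
  then have "card (?f ` ?D) = card ?D"
    by (rule card_image)
  also have "\<dots> = (card E choose k) * (card X - card E)"
    using card_Diff_subset[OF finE E] by (simp add: card_cartesian_product)
  finally have card: "card (?f ` ?D) = (card E choose k) * (card X - card E)" .
  have sub: "?f ` ?D \<subseteq> [X]\<^bsup>(k + 1)\<^esup>"
    using E by (auto simp: nsets_def card_insert_if)
  have disj: "uncovered_sets k X {E} \<inter> ?f ` ?D = {}"
    by (auto simp: uncovered_sets_def covered_sets_def nsets_def)
  have finN: "finite ([X]\<^bsup>(k + 1)\<^esup>)"
    using fin by (rule finite_imp_finite_nsets)
  have "card (uncovered_sets k X {E}) + card (?f ` ?D) = card (uncovered_sets k X {E} \<union> ?f ` ?D)"
    using disj finite_subset[OF uncovered_sets_subset finN] finite_subset[OF sub finN]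
    by (intro card_Un_disjoint[symmetric])
  also have "\<dots> \<le> card ([X]\<^bsup>(k + 1)\<^esup>)"
    using sub uncovered_sets_subset[of k X "{E}"] by (intro card_mono[OF finN]) simp
  finally show ?thesis
    by (simp only: card card_nsets)
qed

lemma weight_single_edge_le:
  assumes H: "hypergraph X {E}" and m: "card E = m" "card X = 2 * m" "k \<le> m" and k: "2 \<le> k"
  shows "weight k X {E} \<le> 1 - real (m choose k) / real (2 * m choose k) / 2"
proof -
  have fin: "finite X" "E \<subseteq> X"
    using H by (auto simp: hypergraph_def)
  define a b c where "a = real (m choose k)" and "b = real (2 * m choose k)"
    and "c = real (2 * m choose (k + 1))"
  have pos: "a > 0" "b > 0" "c > 0"
    using m(3) k by (simp_all add: a_def b_def c_def)
  have cov: "card (covered_sets k {E}) = m choose k"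
    by (simp add: covered_sets_def m(1))
  have "card (uncovered_sets k X {E}) + (m choose k) * m \<le> 2 * m choose (k + 1)"
    using card_uncovered_single_edge[OF fin, of k] m by simp
  then have unc: "real (card (uncovered_sets k X {E})) \<le> c - a * real m"
    unfolding a_def c_def by (metis le_diff_eq of_nat_add of_nat_le_iff of_nat_mult)
  have "(k + 1) * (2 * m choose (k + 1)) = (2 * m - k) * (2 * m choose k)"
    using binomial_absorb_comp[of "2 * m" k] binomial_absorption[of k "2 * m"] by simp
  also have "\<dots> \<le> 2 * m * (2 * m choose k)"
    by simp
  finally have "real ((k + 1) * (2 * m choose (k + 1))) \<le> real (2 * m * (2 * m choose k))"
    by (simp only: of_nat_le_iff)
  then have kc: "(real k + 1) * c \<le> 2 * real m * b"
    by (simp add: b_def c_def algebra_simps)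
  have "3 * c \<le> (real k + 1) * c"
    using k pos by (intro mult_right_mono) auto
  with kc have "3 * c \<le> 2 * real m * b"
    by simp
  \<comment> \<open>\<open>a * real m\<close> counts the \<open>(k+1)\<close>-sets with one vertex outside \<open>E\<close>; as their density is at least
    \<open>3 / 2\<close> of that of the \<open>k\<close>-subsets of \<open>E\<close>, the edge saves at least \<open>1 / 2\<close> of the latter\<close>
  then have "a * (3 * c) \<le> a * (2 * real m * b)"
    using pos by (intro mult_left_mono) auto
  then have dens: "3 / 2 * (a / b) \<le> a * real m / c"
    using pos by (simp add: field_simps)
  have "weight k X {E} = a / b + real (card (uncovered_sets k X {E})) / c"
    by (simp add: weight_eq_card[OF H] cov m(2) a_def b_def c_def)
  also have "\<dots> \<le> a / b + (c - a * real m) / c"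
    using unc pos by (intro add_left_mono divide_right_mono) auto
  also have "\<dots> = a / b + 1 - a * real m / c"
    using pos by (simp add: diff_divide_distrib)
  finally show ?thesis
    using dens by (simp add: a_def b_def)
qed

lemma binomial_ratio_double_ge:
  assumes "k \<le> m" "0 < k"
  shows "(1 / (2 * real k)) ^ k \<le> real (m choose k) / real (2 * m choose k)"
proof -
  have pos: "real (2 * m choose k) > 0"
    using assms by simp
  have "(1 / (2 * real k)) ^ k * real (2 * m choose k) \<le> (1 / (2 * real k)) ^ k * (2 * real m) ^ k"
  proof (rule mult_left_mono)
    have "real (2 * m choose k) \<le> real ((2 * m) ^ k)"
      using binomial_le_pow[of k "2 * m"] assms by (simp only: of_nat_le_iff)
    then show "real (2 * m choose k) \<le> (2 * real m) ^ k"
      by simp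
  qed simp
  also have "\<dots> = (real m / real k) ^ k"
    by (subst power_mult_distrib[symmetric]) simp
  also have "\<dots> \<le> real (m choose k)"
    using binomial_ge_n_over_k_pow_k[of k m, where 'a = real] assms(1) by simp
  finally show ?thesis
    using pos by (simp add: pos_le_divide_eq)
qed

text \<open>
  The construction has an even number of vertices; by monotonicity its bound on \<open>2 n\<close> vertices
  holds on \<open>n\<close> vertices too.
\<close>

lemma min_weight_linear_le:
  assumes "k + 1 \<le> n" "2 \<le> k"
  shows "min_weight_linear n k \<le> 1 - (1 / (2 * real k)) ^ k / 2"
proof -
  have "min_weight_linear n k \<le> min_weight_linear (2 * n) k"
  proof -
    have "min_weight_linear n k \<le> min_weight_linear (n + d) k" for d
    proof (induction d)
      case (Suc d)
      have "min_weight_linear (n + d) k \<le> min_weight_linear (n + Suc d) k"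
        using min_weight_linear_mono[of k "n + d"] assms by simp
      with Suc show ?case
        by (rule order_trans)
    qed simp
    from this[of n] show ?thesis
      by (simp add: mult_2)
  qed
  also have "\<dots> \<le> weight k {..<2 * n} {{..<n}}"
  proof -
    have "hypergraph {..<2 * n} {{..<n}}" "card {..<2 * n} = 2 * n"
      "linear_edges (k - 1) {{..<n}}"
      by (auto simp: hypergraph_def linear_edges_def)
    then show ?thesis
      unfolding min_weight_linear_def by (intro Min_le[OF finite_weights]) blast
  qed
  also have "\<dots> \<le> 1 - real (n choose k) / real (2 * n choose k) / 2"
    using assms by (intro weight_single_edge_le) (auto simp: hypergraph_def)
  also have "\<dots> \<le> 1 - (1 / (2 * real k)) ^ k / 2"
    using binomial_ratio_double_ge[of k n] assms by simp
  finally show ?thesis .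
qed

section \<open>Existence and bounds of the limits\<close>

lemma eventually_mono_bounded_convergent:
  fixes f :: "nat \<Rightarrow> real"
  assumes mono: "\<And>n. N \<le> n \<Longrightarrow> f n \<le> f (Suc n)" and bound: "\<And>n. N \<le> n \<Longrightarrow> f n \<le> B"
  obtains L where "f \<longlonglongrightarrow> L" "f N \<le> L" "L \<le> B"
proof -
  have inc: "incseq (\<lambda>n. f (n + N))"
    using mono by (intro incseq_SucI) simp
  then obtain L where L: "(\<lambda>n. f (n + N)) \<longlonglongrightarrow> L" "\<forall>n. f (n + N) \<le> L"
    using incseq_convergent[OF inc, of B] bound by auto
  have "f \<longlonglongrightarrow> L"
    using L(1) by (rule LIMSEQ_offset)
  moreover have "f N \<le> L"
    using L(2)[rule_format, of 0] by simp
  moreover have "L \<le> B"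
    using L(1) bound by (intro LIMSEQ_le_const2[OF L(1)]) auto
  ultimately show ?thesis
    using that by blast
qed

theorem theorem8:
  fixes k :: nat
  assumes "k \<ge> 2"
  shows "\<exists>s\<^sub>k s'\<^sub>k :: real.
           (\<lambda>n. min_weight_linear n k) \<longlonglongrightarrow> s\<^sub>k \<and> (\<lambda>n. min_weight n k) \<longlonglongrightarrow> s'\<^sub>k \<and>
           0 < s'\<^sub>k \<and> s'\<^sub>k \<le> s\<^sub>k \<and> s\<^sub>k < 1"
proof -
  define B where "B = 1 - (1 / (2 * real k)) ^ k / 2"
  have "B < 1"
    using assms by (simp add: B_def)
  have bound: "min_weight_linear n k \<le> B" if "k + 1 \<le> n" for n
    unfolding B_def using that assms by (rule min_weight_linear_le)
  obtain s where s: "(\<lambda>n. min_weight_linear n k) \<longlonglongrightarrow> s" "s \<le> B"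
    by (rule eventually_mono_bounded_convergent[of "k + 1" "\<lambda>n. min_weight_linear n k" B])
      (use min_weight_linear_mono bound in auto)
  obtain s' where s': "(\<lambda>n. min_weight n k) \<longlonglongrightarrow> s'" "min_weight (k + 1) k \<le> s'"
    by (rule eventually_mono_bounded_convergent[of "k + 1" "\<lambda>n. min_weight n k" B])
      (use min_weight_mono order_trans[OF min_weight_le_linear bound] in auto)
  have "0 < s'"
    using min_weight_pos[of k "k + 1"] s'(2) by simp
  moreover have "s' \<le> s"
    using s'(1) s(1) min_weight_le_linear by (intro LIMSEQ_le) auto
  ultimately show ?thesis
    using s s'(1) \<open>B < 1\<close> by (intro exI[of _ s] exI[of _ s']) auto
qed

end
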